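(* Let $E$ be a normed vector space. (1) Let $A$ be a non-empty internal subset of $\mathcal G_E$ and $u\in\mathcal G_E$. Then there exists $a\in A$ such that $\|u-a\|=\min_{v\in A}\|u-v\|$ (minimum in $\widetilde{\mathbb R}$). (2) Let $A$ be a sharply bounded, non-empty internal subset of $\mathcal G_E$. Then $\{\|u\|:u\in A\}$ reaches a maximum (in $\widetilde{\mathbb R}$). (3) A sharply bounded, non-empty internal subset of $\mathcal G_E$ is not open (in the sharp topology).
   Context: For a normed space $E$: a net $(u_\varepsilon)_\varepsilon\in E^{(0,1)}$ is moderate if there are $M\in\mathbb N$ and $\eta\in(0,1)$ with $\|u_\varepsilon\|\le\varepsilon^{-M}$ for all $\varepsilon\le\eta$; it is negligible if for each $m\in\mathbb N$ there is $\eta\in(0,1)$ with $\|u_\varepsilon\|\le\varepsilon^m$ for all $\varepsilon\le\eta$. The Colombeau space $\mathcal G_E$ is the quotient of the moderate nets by the negligible nets; a net in the class $u\in\mathcal G_E$ is a representative of $u$. $\widetilde{\mathbb R}=\mathcal G_{\mathbb R}$, ordered by: $x\le y$ iff there are representatives with $x_\varepsilon\le y_\varepsilon$ for all sufficiently small $\varepsilon$. The norm induces $\|\cdot\|:\mathcal G_E\to\widetilde{\mathbb R}$, $\|[(u_\varepsilon)_\varepsilon]\|=[(\|u_\varepsilon\|)_\varepsilon]$. $\alpha\in\widetilde{\mathbb R}$ has representative $(\varepsilon)_\varepsilon$. For $x=[(x_\varepsilon)_\varepsilon]\in\widetilde{\mathbb R}$, $\nu(x)=\sup\{b\in\mathbb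 R:|x_\varepsilon|=O(\varepsilon^b)\text{ as }\varepsilon\to0\}$ and $|x|_{\mathrm e}=\exp(-\nu(x))$. The sharp topology on $\mathcal G_E$ is the topology generated by the ultrapseudoseminorm $u\mapsto|\,\|u\|\,|_{\mathrm e}$. A subset $A\subseteq\mathcal G_E$ is internal if there is a net $(A_\varepsilon)_{\varepsilon\in(0,1)}$ of subsets of $E$ such that $A=[(A_\varepsilon)_\varepsilon]$, the set of all $u\in\mathcal G_E$ for which there exist a representative $(u_\varepsilon)_\varepsilon$ of $u$ and $\eta>0$ such that $u_\varepsilon\in A_\varepsilon$ for all $\varepsilon<\eta$. A subset $A\subseteq\mathcal G_E$ is sharply bounded if there is $M\in\mathbb N$ with $\|u\|\le\alpha^{-M}$ for all $u\in A$.
   Formalization: Part (3) is stated for a normed space E that is not the zero space; for E = {0} it fails, since the space G_E = {0} is itself a sharply bounded, non-empty internal set that is open. *)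

theory Defs
  imports "HOL-Analysis.Analysis" "HOL-Library.Landau_Symbols"
begin

text \<open>
  A net indexed by the interval (0,1) is a function on \<^typ>\<open>real\<close> of which only the values on
  \<^term>\<open>{0<..<1::real}\<close> are ever used; nets that differ only outside this interval are identified
  by the quotient construction below.
\<close>

definition moderate :: "(real \<Rightarrow> 'a::real_normed_vector) \<Rightarrow> bool" where
  "moderate u \<longleftrightarrow> (\<exists>M::nat. \<exists>\<eta>\<in>{0<..<1}. \<forall>\<epsilon>\<in>{0<..\<eta>}. norm (u \<epsilon>) \<le> 1 / \<epsilon> ^ M)"

definition negligible_net :: "(real \<Rightarrow> 'a::real_normed_vector) \<Rightarrow> bool" where
  "negligible_net u \<longleftrightarrow> (\<forall>m::nat. \<exists>\<eta>\<in>{0<..<1}. \<forall>\<epsilon>\<in>{0<..\<eta>}. norm (u \<epsilon>) \<le> \<epsilon> ^ m)"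

lemma ex_small_iff_eventually:
  "(\<exists>\<eta>\<in>{0<..<1::real}. \<forall>\<epsilon>\<in>{0<..\<eta>}. P \<epsilon>) \<longleftrightarrow> eventually P (at_right 0)"
proof
  assume "\<exists>\<eta>\<in>{0<..<1::real}. \<forall>\<epsilon>\<in>{0<..\<eta>}. P \<epsilon>"
  then show "eventually P (at_right 0)"
    unfolding eventually_at_right_field by force
next
  assume "eventually P (at_right 0)"
  then obtain b where b: "b > 0" "\<And>y. 0 < y \<Longrightarrow> y < b \<Longrightarrow> P y"
    unfolding eventually_at_right_field by auto
  then show "\<exists>\<eta>\<in>{0<..<1::real}. \<forall>\<epsilon>\<in>{0<..\<eta>}. P \<epsilon>"
    by (intro bexI[of _ "min b 1 / 2"]) auto
qed

lemma moderate_iff_eventually: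
  "moderate u \<longleftrightarrow> (\<exists>M::nat. \<forall>\<^sub>F \<epsilon> in at_right 0. norm (u \<epsilon>) \<le> 1 / \<epsilon> ^ M)"
  unfolding moderate_def ex_small_iff_eventually ..

lemma negligible_net_iff_eventually:
  "negligible_net u \<longleftrightarrow> (\<forall>m::nat. \<forall>\<^sub>F \<epsilon> in at_right 0. norm (u \<epsilon>) \<le> \<epsilon> ^ m)"
  unfolding negligible_net_def ex_small_iff_eventually ..

lemma eventually_small: "c > 0 \<Longrightarrow> \<forall>\<^sub>F \<epsilon> in at_right (0::real). 0 < \<epsilon> \<and> \<epsilon> < c"
  unfolding eventually_at_right_field by auto

lemma moderate_const: "moderate (\<lambda>\<epsilon>. c)"
proof -
  have "0 < 1 / (norm c + 1)" by (simp add: add_nonneg_pos)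
  from eventually_small[OF this]
  have "\<forall>\<^sub>F \<epsilon> in at_right 0. norm c \<le> 1 / \<epsilon> ^ 1"
  proof eventually_elim
    case (elim \<epsilon>)
    have "0 < norm c + 1" by (simp add: add_nonneg_pos)
    then have "\<epsilon> * (norm c + 1) \<le> 1" using elim by (simp add: field_simps)
    then have "norm c * \<epsilon> \<le> 1" using elim by (simp add: algebra_simps)
    then show ?case using elim by (simp add: field_simps)
  qed
  then show ?thesis unfolding moderate_iff_eventually by blast
qed

lemma moderate_add: assumes "moderate u" "moderate v" shows "moderate (\<lambda>\<epsilon>. u \<epsilon> + v \<epsilon>)"
proof -
  from assms obtain M N :: nat where
    1: "\<forall>\<^sub>F \<epsilon> in at_right 0. norm (u \<epsilon>) \<le> 1 / \<epsilon> ^ M" and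
    2: "\<forall>\<^sub>F \<epsilon> in at_right 0. norm (v \<epsilon>) \<le> 1 / \<epsilon> ^ N"
    unfolding moderate_iff_eventually by blast
  have 3: "\<forall>\<^sub>F \<epsilon> in at_right (0::real). 0 < \<epsilon> \<and> \<epsilon> < 1/2" by (rule eventually_small) simp
  from 1 2 3 have "\<forall>\<^sub>F \<epsilon> in at_right 0. norm (u \<epsilon> + v \<epsilon>) \<le> 1 / \<epsilon> ^ (M + N + 1)"
  proof eventually_elim
    case (elim \<epsilon>)
    have "\<epsilon> ^ (M + N) \<le> \<epsilon> ^ M" "\<epsilon> ^ (M + N) \<le> \<epsilon> ^ N"
      using elim by (auto intro!: power_decreasing)
    then have "1 / \<epsilon> ^ M \<le> 1 / \<epsilon> ^ (M + N)" "1 / \<epsilon> ^ N \<le> 1 / \<epsilon> ^ (M + N)"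
      using elim by (auto intro!: divide_left_mono)
    moreover have "norm (u \<epsilon> + v \<epsilon>) \<le> norm (u \<epsilon>) + norm (v \<epsilon>)" by (rule norm_triangle_ineq)
    ultimately have "norm (u \<epsilon> + v \<epsilon>) \<le> 2 * (1 / \<epsilon> ^ (M + N))" using elim by linarith
    also have "\<dots> \<le> (1 / \<epsilon>) * (1 / \<epsilon> ^ (M + N))"
      using elim by (intro mult_right_mono) (auto simp: field_simps)
    finally show ?case by (simp add: field_simps)
  qed
  then show ?thesis unfolding moderate_iff_eventually by blast
qed

lemma moderate_minus: "moderate u \<Longrightarrow> moderate (\<lambda>\<epsilon>. - u \<epsilon>)"
  unfolding moderate_def by simp

lemma moderate_diff: "moderate u \<Longrightarrow> moderate v \<Longrightarrow> moderate (\<lambda>\<epsilon>. u \<epsilon> - v \<epsilon>)"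
  using moderate_add[of u "\<lambda>\<epsilon>. - v \<epsilon>"] moderate_minus[of v] by simp

lemma moderate_norm: "moderate u \<Longrightarrow> moderate (\<lambda>\<epsilon>. norm (u \<epsilon>))"
  unfolding moderate_def by simp

lemma moderate_mult:
  fixes u v :: "real \<Rightarrow> 'a::real_normed_algebra"
  assumes "moderate u" "moderate v" shows "moderate (\<lambda>\<epsilon>. u \<epsilon> * v \<epsilon>)"
proof -
  from assms obtain M N :: nat where
    1: "\<forall>\<^sub>F \<epsilon> in at_right 0. norm (u \<epsilon>) \<le> 1 / \<epsilon> ^ M" and
    2: "\<forall>\<^sub>F \<epsilon> in at_right 0. norm (v \<epsilon>) \<le> 1 / \<epsilon> ^ N"
    unfolding moderate_iff_eventually by blast
  from 1 2 eventually_small[OF zero_less_one]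
  have "\<forall>\<^sub>F \<epsilon> in at_right 0. norm (u \<epsilon> * v \<epsilon>) \<le> 1 / \<epsilon> ^ (M + N)"
  proof eventually_elim
    case (elim \<epsilon>)
    have "norm (u \<epsilon> * v \<epsilon>) \<le> norm (u \<epsilon>) * norm (v \<epsilon>)" by (rule norm_mult_ineq)
    also have "\<dots> \<le> (1 / \<epsilon> ^ M) * (1 / \<epsilon> ^ N)" using elim by (intro mult_mono) auto
    finally show ?case by (simp add: power_add)
  qed
  then show ?thesis unfolding moderate_iff_eventually by blast
qed

lemma negligible_net_zero: "negligible_net (\<lambda>\<epsilon>. 0)"
  unfolding negligible_net_def by (intro allI bexI[of _ "1/2"]) auto

lemma negligible_net_add:
  assumes "negligible_net u" "negligible_net v" shows "negligible_net (\<lambda>\<epsilon>. u \<epsilon> + v \<epsilon>)"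
  unfolding negligible_net_iff_eventually
proof
  fix m :: nat
  from assms have
    1: "\<forall>\<^sub>F \<epsilon> in at_right 0. norm (u \<epsilon>) \<le> \<epsilon> ^ Suc m" and
    2: "\<forall>\<^sub>F \<epsilon> in at_right 0. norm (v \<epsilon>) \<le> \<epsilon> ^ Suc m"
    unfolding negligible_net_iff_eventually by blast+
  have 3: "\<forall>\<^sub>F \<epsilon> in at_right (0::real). 0 < \<epsilon> \<and> \<epsilon> < 1/2" by (rule eventually_small) simp
  from 1 2 3 show "\<forall>\<^sub>F \<epsilon> in at_right 0. norm (u \<epsilon> + v \<epsilon>) \<le> \<epsilon> ^ m"
  proof eventually_elim
    case (elim \<epsilon>)
    have "norm (u \<epsilon> + v \<epsilon>) \<le> norm (u \<epsilon>) + norm (v \<epsilon>)" by (rule norm_triangle_ineq)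
    also have "\<dots> \<le> 2 * \<epsilon> * \<epsilon> ^ m" using elim by simp
    also have "\<dots> \<le> 1 * \<epsilon> ^ m" using elim by (intro mult_right_mono) auto
    finally show ?case by simp
  qed
qed

lemma negligible_net_minus: "negligible_net u \<Longrightarrow> negligible_net (\<lambda>\<epsilon>. - u \<epsilon>)"
  unfolding negligible_net_def by simp

lemma negligible_net_le:
  assumes "negligible_net u" "\<And>\<epsilon>. norm (v \<epsilon>) \<le> norm (u \<epsilon>)" shows "negligible_net v"
  using assms unfolding negligible_net_def by (meson order_trans)

lemma negligible_net_mult:
  fixes u v :: "real \<Rightarrow> 'a::real_normed_algebra"
  assumes "moderate u" "negligible_net v"
  shows "negligible_net (\<lambda>\<epsilon>. u \<epsilon> * v \<epsilon>)" "negligible_net (\<lambda>\<epsilon>. v \<epsilon> * u \<epsilon>)"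
proof -
  from assms(1) obtain M :: nat where
    1: "\<forall>\<^sub>F \<epsilon> in at_right 0. norm (u \<epsilon>) \<le> 1 / \<epsilon> ^ M"
    unfolding moderate_iff_eventually by blast
  have *: "\<forall>\<^sub>F \<epsilon> in at_right 0. norm (u \<epsilon>) * norm (v \<epsilon>) \<le> \<epsilon> ^ m" for m
  proof -
    have 2: "\<forall>\<^sub>F \<epsilon> in at_right 0. norm (v \<epsilon>) \<le> \<epsilon> ^ (M + m)"
      using assms(2) unfolding negligible_net_iff_eventually by blast
    from 1 2 eventually_small[OF zero_less_one] show ?thesis
    proof eventually_elim
      case (elim \<epsilon>)
      have "norm (u \<epsilon>) * norm (v \<epsilon>) \<le> (1 / \<epsilon> ^ M) * \<epsilon> ^ (M + m)"
        using elim by (intro mult_mono) auto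
      then show ?case using elim by (simp add: power_add)
    qed
  qed
  show "negligible_net (\<lambda>\<epsilon>. u \<epsilon> * v \<epsilon>)"
    unfolding negligible_net_iff_eventually
    using * by (blast intro: eventually_mono order_trans[OF norm_mult_ineq])
  show "negligible_net (\<lambda>\<epsilon>. v \<epsilon> * u \<epsilon>)"
    unfolding negligible_net_iff_eventually
    using *[unfolded mult.commute[of "norm (u _)"]]
    by (blast intro: eventually_mono order_trans[OF norm_mult_ineq])
qed

definition colombeau_rel :: "(real \<Rightarrow> 'a::real_normed_vector) \<Rightarrow> (real \<Rightarrow> 'a) \<Rightarrow> bool" where
  "colombeau_rel u v \<longleftrightarrow> moderate u \<and> moderate v \<and> negligible_net (\<lambda>\<epsilon>. u \<epsilon> - v \<epsilon>)"

lemma part_equivp_colombeau_rel: "part_equivp colombeau_rel"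
proof (rule part_equivpI)
  show "\<exists>x. colombeau_rel x (x :: real \<Rightarrow> 'a)"
    by (rule exI[of _ "\<lambda>_. 0"]) (simp add: colombeau_rel_def moderate_const negligible_net_zero)
  show "symp (colombeau_rel :: (real \<Rightarrow> 'a) \<Rightarrow> _)"
    using negligible_net_minus by (fastforce simp: symp_def colombeau_rel_def)
  show "transp (colombeau_rel :: (real \<Rightarrow> 'a) \<Rightarrow> _)"
    using negligible_net_add by (fastforce simp: transp_def colombeau_rel_def)
qed

quotient_type (overloaded) 'a colombeau = "real \<Rightarrow> 'a::real_normed_vector" / partial: colombeau_rel
  by (rule part_equivp_colombeau_rel)

definition representatives :: "'a::real_normed_vector colombeau \<Rightarrow> (real \<Rightarrow> 'a) set" where
  "representatives u = {f. moderate f \<and> abs_colombeau f = u}"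

instantiation colombeau :: (real_normed_vector) ab_group_add
begin

lift_definition zero_colombeau :: "'a colombeau" is "\<lambda>\<epsilon>. 0"
  by (simp add: colombeau_rel_def moderate_const negligible_net_zero)

lift_definition plus_colombeau :: "'a colombeau \<Rightarrow> 'a colombeau \<Rightarrow> 'a colombeau"
  is "\<lambda>u v \<epsilon>. u \<epsilon> + v \<epsilon>"
proof -
  fix u u' v v' :: "real \<Rightarrow> 'a"
  assume "colombeau_rel u u'" "colombeau_rel v v'"
  then show "colombeau_rel (\<lambda>\<epsilon>. u \<epsilon> + v \<epsilon>) (\<lambda>\<epsilon>. u' \<epsilon> + v' \<epsilon>)"
    using negligible_net_add[of "\<lambda>\<epsilon>. u \<epsilon> - u' \<epsilon>" "\<lambda>\<epsilon>. v \<epsilon> - v' \<epsilon>"]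
    by (simp add: colombeau_rel_def moderate_add algebra_simps)
qed

lift_definition uminus_colombeau :: "'a colombeau \<Rightarrow> 'a colombeau" is "\<lambda>u \<epsilon>. - u \<epsilon>"
proof -
  fix u u' :: "real \<Rightarrow> 'a"
  assume "colombeau_rel u u'"
  then show "colombeau_rel (\<lambda>\<epsilon>. - u \<epsilon>) (\<lambda>\<epsilon>. - u' \<epsilon>)"
    using negligible_net_minus[of "\<lambda>\<epsilon>. u \<epsilon> - u' \<epsilon>"]
    by (simp add: colombeau_rel_def moderate_minus)
qed

definition minus_colombeau :: "'a colombeau \<Rightarrow> 'a colombeau \<Rightarrow> 'a colombeau" where
  "minus_colombeau u v = u + (- v)"

instance
proof
  fix a b c :: "'a colombeau"
  show "a + b + c = a + (b + c)"
    by transfer (simp add: colombeau_rel_def moderate_add negligible_net_zero add.assoc)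
  show "a + b = b + a"
    by transfer (simp add: colombeau_rel_def moderate_add negligible_net_zero add.commute)
  show "0 + a = a"
    by transfer (simp add: colombeau_rel_def)
  show "- a + a = 0"
    by transfer (simp add: colombeau_rel_def moderate_const negligible_net_zero)
  show "a - b = a + - b"
    by (simp add: minus_colombeau_def)
qed

end

instantiation colombeau :: (real_normed_field) comm_ring_1
begin

lift_definition one_colombeau :: "'a colombeau" is "\<lambda>\<epsilon>. 1"
  by (simp add: colombeau_rel_def moderate_const negligible_net_zero)

lift_definition times_colombeau :: "'a colombeau \<Rightarrow> 'a colombeau \<Rightarrow> 'a colombeau"
  is "\<lambda>u v \<epsilon>. u \<epsilon> * v \<epsilon>"
proof -
  fix u u' v v' :: "real \<Rightarrow> 'a"
  assume a: "colombeau_rel u u'" "colombeau_rel v v'"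
  then have "negligible_net (\<lambda>\<epsilon>. (u \<epsilon> - u' \<epsilon>) * v \<epsilon>)" "negligible_net (\<lambda>\<epsilon>. u' \<epsilon> * (v \<epsilon> - v' \<epsilon>))"
    using negligible_net_mult by (auto simp: colombeau_rel_def)
  from negligible_net_add[OF this] a
  show "colombeau_rel (\<lambda>\<epsilon>. u \<epsilon> * v \<epsilon>) (\<lambda>\<epsilon>. u' \<epsilon> * v' \<epsilon>)"
    by (simp add: colombeau_rel_def moderate_mult algebra_simps)
qed

instance
proof
  fix a b c :: "'a colombeau"
  show "a * b * c = a * (b * c)"
    by transfer (simp add: colombeau_rel_def moderate_mult negligible_net_zero mult.assoc)
  show "a * b = b * a"
    by transfer (simp add: colombeau_rel_def moderate_mult negligible_net_zero mult.commute)
  show "1 * a = a"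
    by transfer (simp add: colombeau_rel_def)
  show "(a + b) * c = a * c + b * c"
    by transfer (simp add: colombeau_rel_def moderate_mult moderate_add negligible_net_zero
        distrib_right)
  show "(0 :: 'a colombeau) \<noteq> 1"
  proof (transfer, rule notI)
    assume "colombeau_rel (\<lambda>\<epsilon>. 0) (\<lambda>\<epsilon>. 1 :: 'a)"
    then have "\<forall>\<^sub>F \<epsilon> in at_right (0::real). 1 \<le> \<epsilon> ^ 1"
      unfolding colombeau_rel_def negligible_net_iff_eventually
      by (metis norm_minus_commute diff_zero norm_one)
    from eventually_conj[OF this eventually_small[OF zero_less_one]]
    have "\<forall>\<^sub>F \<epsilon> in at_right (0::real). False" by eventually_elim auto
    then show False by simp
  qed
qed

end

type_synonym gen_real = "real colombeau"

definition gen_real_le :: "gen_real \<Rightarrow> gen_real \<Rightarrow> bool"  (infix \<open>\<le>\<^sub>G\<close> 50) where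
  "x \<le>\<^sub>G y \<longleftrightarrow> (\<exists>f\<in>representatives x. \<exists>g\<in>representatives y. \<forall>\<^sub>F \<epsilon> in at_right 0. f \<epsilon> \<le> g \<epsilon>)"

definition is_minimum :: "gen_real \<Rightarrow> gen_real set \<Rightarrow> bool" where
  "is_minimum m S \<longleftrightarrow> m \<in> S \<and> (\<forall>x\<in>S. m \<le>\<^sub>G x)"

definition is_maximum :: "gen_real \<Rightarrow> gen_real set \<Rightarrow> bool" where
  "is_maximum m S \<longleftrightarrow> m \<in> S \<and> (\<forall>x\<in>S. x \<le>\<^sub>G m)"

lift_definition gen_norm :: "'a::real_normed_vector colombeau \<Rightarrow> gen_real" is "\<lambda>u \<epsilon>. norm (u \<epsilon>)"
proof -
  fix u u' :: "real \<Rightarrow> 'a"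
  assume a: "colombeau_rel u u'"
  then have "negligible_net (\<lambda>\<epsilon>. norm (u \<epsilon>) - norm (u' \<epsilon>))"
    using negligible_net_le[of "\<lambda>\<epsilon>. u \<epsilon> - u' \<epsilon>" "\<lambda>\<epsilon>. norm (u \<epsilon>) - norm (u' \<epsilon>)"]
    by (simp add: colombeau_rel_def norm_triangle_ineq3)
  with a show "colombeau_rel (\<lambda>\<epsilon>. norm (u \<epsilon>)) (\<lambda>\<epsilon>. norm (u' \<epsilon>))"
    by (simp add: colombeau_rel_def moderate_norm)
qed

lemma moderate_ident: "moderate (\<lambda>\<epsilon>. \<epsilon> :: real)"
  unfolding moderate_def by (intro exI[of _ 0] bexI[of _ "1/2"]) auto

lemma moderate_inverse_ident: "moderate (\<lambda>\<epsilon>. inverse \<epsilon> :: real)"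
  unfolding moderate_def by (intro exI[of _ 1] bexI[of _ "1/2"]) (auto simp: field_simps)

lift_definition gen_alpha :: gen_real is "\<lambda>\<epsilon>. \<epsilon>"
  by (simp add: colombeau_rel_def moderate_ident negligible_net_zero)

lift_definition gen_alpha_inv :: gen_real is "\<lambda>\<epsilon>. inverse \<epsilon>"
  by (simp add: colombeau_rel_def moderate_inverse_ident negligible_net_zero)

lemma gen_alpha_inv: "gen_alpha * gen_alpha_inv = 1"
proof transfer
  have "negligible_net (\<lambda>\<epsilon>::real. \<epsilon> * inverse \<epsilon> - 1)"
    unfolding negligible_net_def by (intro allI bexI[of _ "1/2"]) auto
  then show "colombeau_rel (\<lambda>\<epsilon>::real. \<epsilon> * inverse \<epsilon>) (\<lambda>\<epsilon>. 1)"
    by (simp add: colombeau_rel_def moderate_const moderate_ident moderate_inverse_ident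
        moderate_mult)
qed

lemma negligible_net_bigo:
  fixes u :: "real \<Rightarrow> real"
  assumes "negligible_net u" shows "u \<in> O[at_right 0](\<lambda>\<epsilon>. \<epsilon> powr b)"
proof -
  define m where "m = nat \<lceil>b\<rceil>"
  have m: "b \<le> real m" unfolding m_def by linarith
  have "\<forall>\<^sub>F \<epsilon> in at_right 0. norm (u \<epsilon>) \<le> \<epsilon> ^ m"
    using assms unfolding negligible_net_iff_eventually by blast
  with eventually_small[OF zero_less_one]
  have "\<forall>\<^sub>F \<epsilon> in at_right 0. norm (u \<epsilon>) \<le> 1 * norm (\<epsilon> powr b)"
  proof eventually_elim
    case (elim \<epsilon>)
    have "\<epsilon> ^ m = \<epsilon> powr real m" using elim by (simp add: powr_realpow)
    also have "\<dots> \<le> \<epsilon> powr b" using elim m by (intro powr_mono') auto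
    finally show ?case using elim by simp
  qed
  then show ?thesis by (rule bigoI)
qed

text \<open>
  The supremum is infinite for the class of \<^term>\<open>0\<close>, hence the extended reals; then
  exp(-\<infinity>) is read as \<^term>\<open>0::real\<close>.
\<close>

lift_definition gen_val :: "gen_real \<Rightarrow> ereal"
  is "\<lambda>x. Sup {ereal b | b. (\<lambda>\<epsilon>. \<bar>x \<epsilon>\<bar>) \<in> O[at_right 0](\<lambda>\<epsilon>. \<epsilon> powr b)}"
proof -
  fix x y :: "real \<Rightarrow> real"
  assume "colombeau_rel x y"
  then have n: "negligible_net (\<lambda>\<epsilon>. x \<epsilon> - y \<epsilon>)" "negligible_net (\<lambda>\<epsilon>. y \<epsilon> - x \<epsilon>)"
    using negligible_net_minus by (fastforce simp: colombeau_rel_def)+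
  have "x \<in> O[at_right 0](\<lambda>\<epsilon>. \<epsilon> powr b) \<longleftrightarrow> y \<in> O[at_right 0](\<lambda>\<epsilon>. \<epsilon> powr b)" for b
  proof
    assume "x \<in> O[at_right 0](\<lambda>\<epsilon>. \<epsilon> powr b)"
    from sum_in_bigo(1)[OF this negligible_net_bigo[OF n(2)]]
    show "y \<in> O[at_right 0](\<lambda>\<epsilon>. \<epsilon> powr b)" by simp
  next
    assume "y \<in> O[at_right 0](\<lambda>\<epsilon>. \<epsilon> powr b)"
    from sum_in_bigo(1)[OF this negligible_net_bigo[OF n(1)]]
    show "x \<in> O[at_right 0](\<lambda>\<epsilon>. \<epsilon> powr b)" by simp
  qed
  then show "Sup {ereal b | b. (\<lambda>\<epsilon>. \<bar>x \<epsilon>\<bar>) \<in> O[at_right 0](\<lambda>\<epsilon>. \<epsilon> powr b)} =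
      Sup {ereal b | b. (\<lambda>\<epsilon>. \<bar>y \<epsilon>\<bar>) \<in> O[at_right 0](\<lambda>\<epsilon>. \<epsilon> powr b)}"
    by simp
qed

definition sharp_abs :: "gen_real \<Rightarrow> real" where
  "sharp_abs x = (if gen_val x = \<infinity> then 0 else exp (- real_of_ereal (gen_val x)))"

definition sharp_ball :: "'a::real_normed_vector colombeau \<Rightarrow> real \<Rightarrow> 'a colombeau set" where
  "sharp_ball u r = {v. sharp_abs (gen_norm (v - u)) < r}"

definition sharp_topology :: "'a::real_normed_vector colombeau topology" where
  "sharp_topology = topology_generated_by {sharp_ball u r | u r. r > 0}"

definition internal_set :: "(real \<Rightarrow> 'a::real_normed_vector set) \<Rightarrow> 'a colombeau set" where
  "internal_set A =
    {u. \<exists>f\<in>representatives u. \<exists>\<eta>>0. \<forall>\<epsilon>\<in>{0<..<1}. \<epsilon> < \<eta> \<longrightarrow> f \<epsilon> \<in> A \<epsilon>}"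

definition internal :: "'a::real_normed_vector colombeau set \<Rightarrow> bool" where
  "internal A \<longleftrightarrow> (\<exists>B. A = internal_set B)"

definition sharply_bounded :: "'a::real_normed_vector colombeau set \<Rightarrow> bool" where
  "sharply_bounded A \<longleftrightarrow> (\<exists>M::nat. \<forall>u\<in>A. gen_norm u \<le>\<^sub>G gen_alpha_inv ^ M)"

end

theory Submission
  imports Defs
begin

text \<open>
  The infimum of \<open>norm (u \<epsilon> - v)\<close> over \<open>v \<in> A \<epsilon>\<close> need not be attained for a single \<open>\<epsilon>\<close>, but in the
  generalized reals an error that is negligible in \<open>\<epsilon>\<close> does not count (\<open>abs_le_abs_iff\<close>). So for
  each \<open>\<epsilon>\<close> one chooses a point of \<open>A \<epsilon>\<close> that is optimal up to \<open>exp (- 1 / \<epsilon>)\<close>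
  (\<open>ex_minimizing_net\<close>). Such a net minimizes over all nets that lie in \<open>A \<epsilon>\<close> for small \<open>\<epsilon>\<close>, hence
  over all members of the internal set, provided that it is moderate. For the distance to \<open>u\<close>
  it is moderate by comparison with a known member.

  For the maximum of the norm, the sets \<open>A \<epsilon>\<close> themselves may be unbounded even though the internal
  set is sharply bounded: \<open>{0, exp (1 / \<epsilon>)}\<close> represents \<open>{0}\<close>. Cutting them down to a ball whose
  radius exceeds the sharp bound by 1 does not change the internal set (\<open>internal_set_truncate\<close>), and
  then near-maximizers exist and are moderate.

  Finally, each sharp neighbourhood of \<open>a\<close> contains, for some \<open>m\<close>, all points whose distance from
  \<open>a\<close> is represented by \<open>\<epsilon> ^ m\<close> (\<open>openin_sharp_nhd\<close>). If \<open>a\<close> has maximal norm in an open internal set,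
  moving \<open>a\<close> radially outwards by \<open>\<epsilon> ^ m\<close> gives a member whose norm is larger by \<open>\<epsilon> ^ m\<close>, which is
  not negligible; this contradicts maximality.
\<close>

section \<open>Representatives, order and norm\<close>

lemma colombeau_rel_refl: "moderate f \<Longrightarrow> colombeau_rel f f"
  by (simp add: colombeau_rel_def negligible_net_zero)

lemma abs_colombeau_eq_iff:
  assumes "moderate f" "moderate g"
  shows "abs_colombeau f = abs_colombeau g \<longleftrightarrow> negligible_net (\<lambda>\<epsilon>. f \<epsilon> - g \<epsilon>)"
  using Quotient3_rel[OF Quotient3_colombeau, of f g] assms
  by (auto simp: colombeau_rel_def negligible_net_zero)

lemma ex_representative: "\<exists>f. moderate f \<and> u = abs_colombeau f"
proof -
  have "colombeau_rel (rep_colombeau u) (rep_colombeau u)"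
    by (rule Quotient3_rep_reflp[OF Quotient3_colombeau])
  moreover have "abs_colombeau (rep_colombeau u) = u"
    by (rule Quotient3_abs_rep[OF Quotient3_colombeau])
  ultimately show ?thesis
    unfolding colombeau_rel_def by metis
qed

lemma gen_norm_abs: "moderate f \<Longrightarrow> gen_norm (abs_colombeau f) = abs_colombeau (\<lambda>\<epsilon>. norm (f \<epsilon>))"
  by (simp add: gen_norm.abs_eq colombeau_rel_refl)

lemma abs_diff:
  "moderate f \<Longrightarrow> moderate g \<Longrightarrow>
    abs_colombeau f - abs_colombeau g = abs_colombeau (\<lambda>\<epsilon>. f \<epsilon> - g \<epsilon>)"
  by (simp add: minus_colombeau_def plus_colombeau.abs_eq uminus_colombeau.abs_eq
      colombeau_rel_refl moderate_minus)

lemma gen_norm_abs_diff: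
  "moderate f \<Longrightarrow> moderate g \<Longrightarrow>
    gen_norm (abs_colombeau f - abs_colombeau g) = abs_colombeau (\<lambda>\<epsilon>. norm (f \<epsilon> - g \<epsilon>))"
  by (simp add: abs_diff gen_norm_abs moderate_diff)

lemma moderate_dominated:
  assumes "moderate u" "\<forall>\<^sub>F \<epsilon> in at_right 0. norm (v \<epsilon>) \<le> norm (u \<epsilon>)"
  shows "moderate v"
proof -
  from assms(1) obtain M :: nat where "\<forall>\<^sub>F \<epsilon> in at_right 0. norm (u \<epsilon>) \<le> 1 / \<epsilon> ^ M"
    unfolding moderate_iff_eventually by blast
  with assms(2) have "\<forall>\<^sub>F \<epsilon> in at_right 0. norm (v \<epsilon>) \<le> 1 / \<epsilon> ^ M"
    by eventually_elim linarith
  then show ?thesis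
    unfolding moderate_iff_eventually by blast
qed

lemma negligible_net_imp_moderate: "negligible_net u \<Longrightarrow> moderate u"
  by (rule moderate_dominated[OF moderate_const[of "1::real"]])
     (use negligible_net_iff_eventually[of u] in \<open>auto dest: spec[of _ 0]\<close>)

lemma moderate_power:
  fixes u :: "real \<Rightarrow> real"
  shows "moderate u \<Longrightarrow> moderate (\<lambda>\<epsilon>. u \<epsilon> ^ n)"
  by (induction n) (auto intro: moderate_const moderate_mult)

text \<open>
  The order is defined through some pair of representatives; this form makes it usable with any
  given pair, moving the freedom of choice into a negligible error term.
\<close>

lemma abs_le_abs_iff:
  assumes "moderate f" "moderate g"
  shows "abs_colombeau f \<le>\<^sub>G abs_colombeau g \<longleftrightarrow>
    (\<exists>n. negligible_net n \<and> (\<forall>\<^sub>F \<epsilon> in at_right 0. f \<epsilon> \<le> g \<epsilon> + n \<epsilon>))"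
proof
  assume "abs_colombeau f \<le>\<^sub>G abs_colombeau g"
  then obtain f' g' where f': "moderate f'" "abs_colombeau f = abs_colombeau f'"
    and g': "moderate g'" "abs_colombeau g' = abs_colombeau g"
    and le: "\<forall>\<^sub>F \<epsilon> in at_right 0. f' \<epsilon> \<le> g' \<epsilon>"
    unfolding gen_real_le_def representatives_def by auto
  let ?n = "\<lambda>\<epsilon>. (f \<epsilon> - f' \<epsilon>) + (g' \<epsilon> - g \<epsilon>)"
  have "negligible_net ?n"
    using f' g' assms by (intro negligible_net_add) (simp_all add: abs_colombeau_eq_iff)
  moreover have "\<forall>\<^sub>F \<epsilon> in at_right 0. f \<epsilon> \<le> g \<epsilon> + ?n \<epsilon>"
    using le by eventually_elim simp
  ultimately show "\<exists>n. negligible_net n \<and> (\<forall>\<^sub>F \<epsilon> in at_right 0. f \<epsilon> \<le> g \<epsilon> + n \<epsilon>)"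
    by blast
next
  assume "\<exists>n. negligible_net n \<and> (\<forall>\<^sub>F \<epsilon> in at_right 0. f \<epsilon> \<le> g \<epsilon> + n \<epsilon>)"
  then obtain n where n: "negligible_net n" "\<forall>\<^sub>F \<epsilon> in at_right 0. f \<epsilon> \<le> g \<epsilon> + n \<epsilon>"
    by blast
  have "moderate (\<lambda>\<epsilon>. g \<epsilon> + n \<epsilon>)"
    using assms(2) negligible_net_imp_moderate[OF n(1)] by (rule moderate_add)
  moreover from this have "abs_colombeau (\<lambda>\<epsilon>. g \<epsilon> + n \<epsilon>) = abs_colombeau g"
    using assms n by (simp add: abs_colombeau_eq_iff)
  ultimately show "abs_colombeau f \<le>\<^sub>G abs_colombeau g"
    using assms(1) n(2) unfolding gen_real_le_def representatives_def
    by (intro bexI[of _ f] bexI[of _ "\<lambda>\<epsilon>. g \<epsilon> + n \<epsilon>"]) auto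
qed

lemma gen_alpha_inv_power: "gen_alpha_inv ^ M = abs_colombeau (\<lambda>\<epsilon>. inverse \<epsilon> ^ M)"
proof (induction M)
  case 0
  show ?case by (simp add: one_colombeau_def)
next
  case (Suc M)
  then show ?case
    by (simp add: gen_alpha_inv_def times_colombeau.abs_eq colombeau_rel_refl
        moderate_inverse_ident moderate_power)
qed

section \<open>Extremal members of internal sets\<close>

lemma mem_internal_set_iff:
  "u \<in> internal_set A \<longleftrightarrow>
    (\<exists>f. moderate f \<and> u = abs_colombeau f \<and> (\<forall>\<^sub>F \<epsilon> in at_right 0. f \<epsilon> \<in> A \<epsilon>))"
proof -
  have "(\<exists>\<eta>>0. \<forall>\<epsilon>\<in>{0<..<1}. \<epsilon> < \<eta> \<longrightarrow> f \<epsilon> \<in> A \<epsilon>) \<longleftrightarrow>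
      (\<forall>\<^sub>F \<epsilon> in at_right 0. f \<epsilon> \<in> A \<epsilon>)" for f
  proof
    assume "\<exists>\<eta>>0. \<forall>\<epsilon>\<in>{0<..<1}. \<epsilon> < \<eta> \<longrightarrow> f \<epsilon> \<in> A \<epsilon>"
    then obtain \<eta> where "\<eta> > 0" "\<forall>\<epsilon>\<in>{0<..<1}. \<epsilon> < \<eta> \<longrightarrow> f \<epsilon> \<in> A \<epsilon>" by blast
    then show "\<forall>\<^sub>F \<epsilon> in at_right 0. f \<epsilon> \<in> A \<epsilon>"
      unfolding eventually_at_right_field by (intro exI[of _ "min \<eta> 1"]) auto
  qed (auto simp: eventually_at_right_field)
  then show ?thesis
    unfolding internal_set_def representatives_def by auto
qed

lemma negligible_net_exp: "negligible_net (\<lambda>\<epsilon>. exp (- inverse \<epsilon>) :: real)"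
  unfolding negligible_net_iff_eventually
proof
  fix m :: nat
  have "((\<lambda>\<epsilon>::real. inverse \<epsilon> ^ m / exp (inverse \<epsilon>)) \<longlongrightarrow> 0) (at_right 0)"
    by (rule filterlim_compose[OF tendsto_power_div_exp_0 filterlim_inverse_at_top_right])
  then have "\<forall>\<^sub>F \<epsilon> in at_right (0::real). inverse \<epsilon> ^ m / exp (inverse \<epsilon>) < 1"
    by (rule order_tendstoD) simp
  with eventually_small[OF zero_less_one]
  show "\<forall>\<^sub>F \<epsilon> in at_right (0::real). norm (exp (- inverse \<epsilon>)) \<le> \<epsilon> ^ m"
  proof eventually_elim
    case (elim \<epsilon>)
    then show ?case by (simp add: exp_minus field_simps)
  qed
qed

text \<open>
  Pointwise near-minimizers, with a tolerance that is positive for each \<open>\<epsilon>\<close> but negligible as a net.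
  The functional may vary with \<open>\<epsilon>\<close>; a maximum is obtained from its negative.
\<close>

lemma ex_minimizing_net:
  fixes \<phi> :: "real \<Rightarrow> 'a::real_normed_vector \<Rightarrow> real"
  assumes "internal_set A \<noteq> {}" and bdd: "\<And>\<epsilon>. bdd_below (\<phi> \<epsilon> ` A \<epsilon>)"
  obtains a \<delta> where "negligible_net \<delta>" "\<forall>\<^sub>F \<epsilon> in at_right 0. a \<epsilon> \<in> A \<epsilon>"
    "\<forall>\<^sub>F \<epsilon> in at_right 0. \<forall>y\<in>A \<epsilon>. \<phi> \<epsilon> (a \<epsilon>) \<le> \<phi> \<epsilon> y + \<delta> \<epsilon>"
proof -
  define \<delta> :: "real \<Rightarrow> real" where "\<delta> = (\<lambda>\<epsilon>. exp (- inverse \<epsilon>))"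
  have near: "\<exists>x\<in>A \<epsilon>. \<forall>y\<in>A \<epsilon>. \<phi> \<epsilon> x \<le> \<phi> \<epsilon> y + \<delta> \<epsilon>" if "A \<epsilon> \<noteq> {}" for \<epsilon>
  proof -
    have "\<exists>z\<in>\<phi> \<epsilon> ` A \<epsilon>. z < Inf (\<phi> \<epsilon> ` A \<epsilon>) + \<delta> \<epsilon>"
      using that bdd cInf_less_iff[of "\<phi> \<epsilon> ` A \<epsilon>" "Inf (\<phi> \<epsilon> ` A \<epsilon>) + \<delta> \<epsilon>"] by (simp add: \<delta>_def)
    then obtain x where x: "x \<in> A \<epsilon>" "\<phi> \<epsilon> x < Inf (\<phi> \<epsilon> ` A \<epsilon>) + \<delta> \<epsilon>" by blast
    have "Inf (\<phi> \<epsilon> ` A \<epsilon>) \<le> \<phi> \<epsilon> y" if "y \<in> A \<epsilon>" for y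
      using bdd that by (intro cInf_lower) auto
    with x(2) have "\<forall>y\<in>A \<epsilon>. \<phi> \<epsilon> x \<le> \<phi> \<epsilon> y + \<delta> \<epsilon>" by force
    with x(1) show ?thesis by blast
  qed
  define a where "a = (\<lambda>\<epsilon>. SOME x. x \<in> A \<epsilon> \<and> (\<forall>y\<in>A \<epsilon>. \<phi> \<epsilon> x \<le> \<phi> \<epsilon> y + \<delta> \<epsilon>))"
  have a: "a \<epsilon> \<in> A \<epsilon> \<and> (\<forall>y\<in>A \<epsilon>. \<phi> \<epsilon> (a \<epsilon>) \<le> \<phi> \<epsilon> y + \<delta> \<epsilon>)" if "A \<epsilon> \<noteq> {}" for \<epsilon>
    unfolding a_def by (rule someI_ex) (use near[OF that] in blast)
  from assms(1) obtain f where "\<forall>\<^sub>F \<epsilon> in at_right 0. f \<epsilon> \<in> A \<epsilon>"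
    using mem_internal_set_iff by blast
  then have ev: "\<forall>\<^sub>F \<epsilon> in at_right 0. A \<epsilon> \<noteq> {}" by eventually_elim blast
  show thesis
    by (rule that[of \<delta> a])
       (use a in \<open>auto simp: \<delta>_def negligible_net_exp intro: eventually_mono[OF ev]\<close>)
qed

lemma ex_nearest_member:
  fixes u :: "'a::real_normed_vector colombeau"
  assumes "internal_set A \<noteq> {}"
  shows "\<exists>a\<in>internal_set A. \<forall>v\<in>internal_set A. gen_norm (u - a) \<le>\<^sub>G gen_norm (u - v)"
proof -
  obtain h where h: "moderate h" "u = abs_colombeau h"
    using ex_representative by blast
  have "bdd_below ((\<lambda>x. norm (h \<epsilon> - x)) ` A \<epsilon>)" for \<epsilon>
    by (rule bdd_belowI[of _ 0]) auto
  from ex_minimizing_net[OF assms this] obtain a \<delta> where \<delta>: "negligible_net \<delta>"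
    and a: "\<forall>\<^sub>F \<epsilon> in at_right 0. a \<epsilon> \<in> A \<epsilon>"
    and min: "\<forall>\<^sub>F \<epsilon> in at_right 0. \<forall>y\<in>A \<epsilon>. norm (h \<epsilon> - a \<epsilon>) \<le> norm (h \<epsilon> - y) + \<delta> \<epsilon>"
    by blast
  obtain f where f: "moderate f" "\<forall>\<^sub>F \<epsilon> in at_right 0. f \<epsilon> \<in> A \<epsilon>"
    using assms mem_internal_set_iff by blast
  have "moderate (\<lambda>\<epsilon>. norm (h \<epsilon>) + (norm (h \<epsilon> - f \<epsilon>) + \<delta> \<epsilon>))"
    using h f negligible_net_imp_moderate[OF \<delta>]
    by (intro moderate_add[of "\<lambda>\<epsilon>. norm (h \<epsilon>)"] moderate_add moderate_norm moderate_diff) auto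
  moreover have "\<forall>\<^sub>F \<epsilon> in at_right 0.
      norm (a \<epsilon>) \<le> norm (norm (h \<epsilon>) + (norm (h \<epsilon> - f \<epsilon>) + \<delta> \<epsilon>))"
    using min f(2)
  proof eventually_elim
    case (elim \<epsilon>)
    then have "norm (h \<epsilon> - a \<epsilon>) \<le> norm (h \<epsilon> - f \<epsilon>) + \<delta> \<epsilon>" by blast
    moreover have "norm (a \<epsilon>) \<le> norm (h \<epsilon>) + norm (h \<epsilon> - a \<epsilon>)"
      by (metis norm_minus_commute norm_triangle_sub)
    ultimately show ?case by simp
  qed
  ultimately have moda: "moderate a"
    by (rule moderate_dominated)
  show ?thesis
  proof (intro bexI[of _ "abs_colombeau a"] ballI)
    show "abs_colombeau a \<in> internal_set A"
      using moda a mem_internal_set_iff by blast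
    fix v assume "v \<in> internal_set A"
    then obtain g where g: "moderate g" "v = abs_colombeau g" "\<forall>\<^sub>F \<epsilon> in at_right 0. g \<epsilon> \<in> A \<epsilon>"
      using mem_internal_set_iff by blast
    have "\<forall>\<^sub>F \<epsilon> in at_right 0. norm (h \<epsilon> - a \<epsilon>) \<le> norm (h \<epsilon> - g \<epsilon>) + \<delta> \<epsilon>"
      using min g(3) by eventually_elim blast
    then show "gen_norm (u - abs_colombeau a) \<le>\<^sub>G gen_norm (u - v)"
      using h g moda \<delta>
      by (auto simp: gen_norm_abs_diff abs_le_abs_iff moderate_diff moderate_norm)
  qed
qed

text \<open>
  The defining inequality \<open>norm u \<le> \<alpha> ^ (- M)\<close> holds for representatives only up to a negligible
  error, which is eventually at most 1; hence the radius of the truncating ball.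
\<close>

lemma internal_set_truncate:
  assumes "sharply_bounded (internal_set A)"
  obtains B R where "internal_set A = internal_set B" "moderate R" "\<And>\<epsilon> x. x \<in> B \<epsilon> \<Longrightarrow> norm x \<le> R \<epsilon>"
proof -
  from assms obtain M :: nat where M: "\<And>u. u \<in> internal_set A \<Longrightarrow> gen_norm u \<le>\<^sub>G gen_alpha_inv ^ M"
    unfolding sharply_bounded_def by blast
  define R :: "real \<Rightarrow> real" where "R = (\<lambda>\<epsilon>. inverse \<epsilon> ^ M + 1)"
  define B where "B = (\<lambda>\<epsilon>. {x \<in> A \<epsilon>. norm x \<le> R \<epsilon>})"
  have "internal_set B \<subseteq> internal_set A"
  proof
    fix u assume "u \<in> internal_set B"
    then obtain f where f: "moderate f" "u = abs_colombeau f" "\<forall>\<^sub>F \<epsilon> in at_right 0. f \<epsilon> \<in> B \<epsilon>"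
      using mem_internal_set_iff by blast
    from f(3) have "\<forall>\<^sub>F \<epsilon> in at_right 0. f \<epsilon> \<in> A \<epsilon>"
      by eventually_elim (simp add: B_def)
    with f show "u \<in> internal_set A"
      using mem_internal_set_iff by blast
  qed
  moreover have "internal_set A \<subseteq> internal_set B"
  proof
    fix u assume u: "u \<in> internal_set A"
    then obtain f where f: "moderate f" "u = abs_colombeau f" "\<forall>\<^sub>F \<epsilon> in at_right 0. f \<epsilon> \<in> A \<epsilon>"
      using mem_internal_set_iff by blast
    from M[OF u] f obtain n where n: "negligible_net n"
      and le: "\<forall>\<^sub>F \<epsilon> in at_right 0. norm (f \<epsilon>) \<le> inverse \<epsilon> ^ M + n \<epsilon>"
      by (auto simp: gen_norm_abs gen_alpha_inv_power abs_le_abs_iff moderate_norm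
          moderate_power moderate_inverse_ident)
    from n have "\<forall>\<^sub>F \<epsilon> in at_right 0. norm (n \<epsilon>) \<le> \<epsilon> ^ 0"
      unfolding negligible_net_iff_eventually by blast
    with le f(3) have "\<forall>\<^sub>F \<epsilon> in at_right 0. f \<epsilon> \<in> B \<epsilon>"
      by eventually_elim (auto simp: B_def R_def)
    with f show "u \<in> internal_set B"
      using mem_internal_set_iff by blast
  qed
  moreover have "moderate R"
    unfolding R_def by (intro moderate_add moderate_power moderate_inverse_ident moderate_const)
  ultimately show thesis
    by (intro that[of B R]) (auto simp: B_def)
qed

lemma ex_max_norm_member:
  fixes A :: "real \<Rightarrow> 'a::real_normed_vector set"
  assumes "sharply_bounded (internal_set A)" "internal_set A \<noteq> {}"
  shows "\<exists>a\<in>internal_set A. \<forall>v\<in>internal_set A. gen_norm v \<le>\<^sub>G gen_norm a"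
proof -
  obtain B R where B: "internal_set A = internal_set B" and R: "moderate R"
    and le: "\<And>\<epsilon> x. x \<in> B \<epsilon> \<Longrightarrow> norm x \<le> R \<epsilon>"
    by (rule internal_set_truncate[OF assms(1)]) blast
  have "bdd_below ((\<lambda>x. - norm x) ` B \<epsilon>)" for \<epsilon>
    by (rule bdd_belowI[of _ "- R \<epsilon>"]) (use le in auto)
  from ex_minimizing_net[OF assms(2)[unfolded B] this] obtain a \<delta> where \<delta>: "negligible_net \<delta>"
    and a: "\<forall>\<^sub>F \<epsilon> in at_right 0. a \<epsilon> \<in> B \<epsilon>"
    and max: "\<forall>\<^sub>F \<epsilon> in at_right 0. \<forall>y\<in>B \<epsilon>. - norm (a \<epsilon>) \<le> - norm y + \<delta> \<epsilon>"
    by blast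
  from a have "\<forall>\<^sub>F \<epsilon> in at_right 0. norm (a \<epsilon>) \<le> norm (R \<epsilon>)"
    by eventually_elim (use le in force)
  then have moda: "moderate a"
    by (rule moderate_dominated[OF R])
  show ?thesis
    unfolding B
  proof (intro bexI[of _ "abs_colombeau a"] ballI)
    show "abs_colombeau a \<in> internal_set B"
      using moda a mem_internal_set_iff by blast
    fix v assume "v \<in> internal_set B"
    then obtain g where g: "moderate g" "v = abs_colombeau g" "\<forall>\<^sub>F \<epsilon> in at_right 0. g \<epsilon> \<in> B \<epsilon>"
      using mem_internal_set_iff by blast
    have "\<forall>\<^sub>F \<epsilon> in at_right 0. norm (g \<epsilon>) \<le> norm (a \<epsilon>) + \<delta> \<epsilon>"
      using max g(3) by eventually_elim force
    then show "gen_norm v \<le>\<^sub>G gen_norm (abs_colombeau a)"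
      using g moda \<delta> by (auto simp: gen_norm_abs abs_le_abs_iff moderate_norm)
  qed
qed

section \<open>Sharp neighbourhoods\<close>

lemma gen_val_abs:
  "moderate f \<Longrightarrow> gen_val (abs_colombeau f) =
    Sup {ereal b | b. f \<in> O[at_right 0](\<lambda>\<epsilon>. \<epsilon> powr b)}"
  by (simp add: gen_val.abs_eq colombeau_rel_refl)

lemma moderate_imp_bigo:
  fixes f :: "real \<Rightarrow> real"
  assumes "moderate f"
  shows "\<exists>b. f \<in> O[at_right 0](\<lambda>\<epsilon>. \<epsilon> powr b)"
proof -
  from assms obtain M :: nat where "\<forall>\<^sub>F \<epsilon> in at_right 0. norm (f \<epsilon>) \<le> 1 / \<epsilon> ^ M"
    unfolding moderate_iff_eventually by blast
  with eventually_small[OF zero_less_one]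
  have "\<forall>\<^sub>F \<epsilon> in at_right 0. norm (f \<epsilon>) \<le> 1 * norm (\<epsilon> powr (- real M))"
    by eventually_elim (simp add: powr_minus powr_realpow field_simps)
  then show ?thesis by (blast intro: bigoI)
qed

text \<open>
  Moderateness excludes the valuation \<open>- \<infinity>\<close>, for which \<^const>\<open>sharp_abs\<close> would take the value 1.
\<close>

lemma sharp_abs_less_iff:
  assumes "moderate f" "s > 0"
  shows "sharp_abs (abs_colombeau f) < s \<longleftrightarrow>
    (\<exists>b > - ln s. f \<in> O[at_right 0](\<lambda>\<epsilon>. \<epsilon> powr b))"
proof -
  let ?S = "{ereal b | b. f \<in> O[at_right 0](\<lambda>\<epsilon>. \<epsilon> powr b)}"
  obtain c where "f \<in> O[at_right 0](\<lambda>\<epsilon>. \<epsilon> powr c)"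
    using moderate_imp_bigo[OF assms(1)] by blast
  then have "ereal c \<le> Sup ?S"
    by (intro Sup_upper) blast
  then have "Sup ?S \<noteq> - \<infinity>"
    by auto
  moreover have "exp (- r) < s \<longleftrightarrow> - ln s < r" for r :: real
    using exp_less_cancel_iff[of "- r" "ln s"] assms(2) by auto
  ultimately have "sharp_abs (abs_colombeau f) < s \<longleftrightarrow> ereal (- ln s) < Sup ?S"
    using assms by (cases "Sup ?S") (simp_all add: sharp_abs_def gen_val_abs)
  also have "\<dots> \<longleftrightarrow> (\<exists>b > - ln s. f \<in> O[at_right 0](\<lambda>\<epsilon>. \<epsilon> powr b))"
    unfolding less_Sup_iff by auto
  finally show ?thesis .
qed

lemma bigo_powr_mono:
  assumes "f \<in> O[at_right 0](\<lambda>\<epsilon>::real. \<epsilon> powr b)" "c \<le> b"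
  shows "f \<in> O[at_right 0](\<lambda>\<epsilon>. \<epsilon> powr c)"
proof -
  have "\<forall>\<^sub>F \<epsilon> in at_right (0::real). norm (\<epsilon> powr b) \<le> 1 * norm (\<epsilon> powr c)"
    using eventually_small[OF zero_less_one]
    by eventually_elim (use assms in \<open>simp add: powr_mono'\<close>)
  then show ?thesis
    by (rule landau_o.big.trans[OF assms(1) bigoI])
qed

text \<open>
  In terms of growth rates, the ultrametric inequality is just the triangle inequality together with
  the fact that \<open>O(\<epsilon> ^ b)\<close> is closed under sums. The induction follows the generation of the topology
  from the balls; arbitrary centres are what makes that inequality necessary.
\<close>

lemma openin_sharp_nhd:
  assumes "openin sharp_topology S" "moderate f" "abs_colombeau f \<in> S"
  shows "\<exists>b. \<forall>g. moderate g \<and> (\<lambda>\<epsilon>. norm (g \<epsilon> - f \<epsilon>)) \<in> O[at_right 0](\<lambda>\<epsilon>. \<epsilon> powr b)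
    \<longrightarrow> abs_colombeau g \<in> S"
proof -
  have "generate_topology_on {sharp_ball u r | u r. r > 0} S"
    using assms(1) unfolding sharp_topology_def by (rule openin_topology_generated_by)
  then show ?thesis
    using assms(3)
  proof (induction rule: generate_topology_on.induct)
    case Empty
    then show ?case by simp
  next
    case (Int S T)
    from Int.IH(1) Int.prems obtain b where
      b: "\<And>g. moderate g \<Longrightarrow> (\<lambda>\<epsilon>. norm (g \<epsilon> - f \<epsilon>)) \<in> O[at_right 0](\<lambda>\<epsilon>. \<epsilon> powr b)
        \<Longrightarrow> abs_colombeau g \<in> S"
      by blast
    from Int.IH(2) Int.prems obtain c where
      c: "\<And>g. moderate g \<Longrightarrow> (\<lambda>\<epsilon>. norm (g \<epsilon> - f \<epsilon>)) \<in> O[at_right 0](\<lambda>\<epsilon>. \<epsilon> powr c)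
        \<Longrightarrow> abs_colombeau g \<in> T"
      by blast
    show ?case
    proof (intro exI[of _ "max b c"] allI impI)
      fix g
      assume g: "moderate g \<and>
        (\<lambda>\<epsilon>. norm (g \<epsilon> - f \<epsilon>)) \<in> O[at_right 0](\<lambda>\<epsilon>. \<epsilon> powr max b c)"
      have "abs_colombeau g \<in> S"
        by (rule b) (use g bigo_powr_mono[where b = "max b c" and c = b] in auto)
      moreover have "abs_colombeau g \<in> T"
        by (rule c) (use g bigo_powr_mono[where b = "max b c" and c = c] in auto)
      ultimately show "abs_colombeau g \<in> S \<inter> T" by blast
    qed
  next
    case (UN K)
    from UN.prems obtain k where k: "k \<in> K" "abs_colombeau f \<in> k" by blast
    with UN.IH[OF k] show ?case by blast
  next
    case (Basis S)
    then obtain u s where S: "S = sharp_ball u s" and s: "s > 0" by blast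
    obtain h where h: "moderate h" "u = abs_colombeau h"
      using ex_representative by blast
    from Basis S s h assms(2) obtain b where
      b: "b > - ln s" "(\<lambda>\<epsilon>. norm (f \<epsilon> - h \<epsilon>)) \<in> O[at_right 0](\<lambda>\<epsilon>. \<epsilon> powr b)"
      by (auto simp: sharp_ball_def gen_norm_abs_diff sharp_abs_less_iff moderate_norm moderate_diff)
    show ?case
    proof (intro exI[of _ b] allI impI)
      fix g assume "moderate g \<and> (\<lambda>\<epsilon>. norm (g \<epsilon> - f \<epsilon>)) \<in> O[at_right 0](\<lambda>\<epsilon>. \<epsilon> powr b)"
      then have g: "moderate g" "(\<lambda>\<epsilon>. norm (g \<epsilon> - f \<epsilon>)) \<in> O[at_right 0](\<lambda>\<epsilon>. \<epsilon> powr b)"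
        by auto
      have "norm (g \<epsilon> - h \<epsilon>) \<le> norm (g \<epsilon> - f \<epsilon>) + norm (f \<epsilon> - h \<epsilon>)" for \<epsilon>
        using norm_triangle_ineq[of "g \<epsilon> - f \<epsilon>" "f \<epsilon> - h \<epsilon>"] by simp
      then have "(\<lambda>\<epsilon>. norm (g \<epsilon> - h \<epsilon>)) \<in>
          O[at_right 0](\<lambda>\<epsilon>. norm (g \<epsilon> - f \<epsilon>) + norm (f \<epsilon> - h \<epsilon>))"
        by (intro landau_o.big_mono always_eventually allI) simp
      also have "(\<lambda>\<epsilon>. norm (g \<epsilon> - f \<epsilon>) + norm (f \<epsilon> - h \<epsilon>)) \<in> O[at_right 0](\<lambda>\<epsilon>. \<epsilon> powr b)"
        using g(2) b(2) by (rule sum_in_bigo)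
      finally show "abs_colombeau g \<in> S"
        using S s h g b(1)
        by (auto simp: sharp_ball_def gen_norm_abs_diff sharp_abs_less_iff moderate_norm
            moderate_diff)
    qed
  qed
qed

text \<open>
  The radial direction \<open>x / norm x\<close> works; if \<open>x = 0\<close>, any unit vector does, and \<open>e\<close> supplies one.
\<close>

lemma ex_outward_direction:
  fixes e :: "'a::real_normed_vector"
  assumes "e \<noteq> 0"
  shows "\<exists>w::'a. norm w = 1 \<and> (\<forall>t\<ge>0. norm (x + t *\<^sub>R w) = norm x + t)"
proof (cases "x = 0")
  case True
  with assms show ?thesis
    by (intro exI[of _ "sgn e"]) (simp add: norm_sgn)
next
  case False
  have "norm (x + t *\<^sub>R sgn x) = norm x + t" if "t \<ge> 0" for t
  proof -
    have "norm x *\<^sub>R sgn x = x"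
      using False by (simp add: sgn_div_norm)
    then have "x + t *\<^sub>R sgn x = (norm x + t) *\<^sub>R sgn x"
      by (simp add: scaleR_add_left)
    with that False show ?thesis by (simp add: norm_sgn)
  qed
  with False show ?thesis
    by (intro exI[of _ "sgn x"]) (simp add: norm_sgn)
qed

lemma not_open_if_max_norm:
  fixes a :: "'a::real_normed_vector colombeau"
  assumes "(e::'a) \<noteq> 0" "a \<in> S" and max: "\<And>v. v \<in> S \<Longrightarrow> gen_norm v \<le>\<^sub>G gen_norm a"
  shows "\<not> openin sharp_topology S"
proof
  assume S: "openin sharp_topology S"
  obtain f where f: "moderate f" "a = abs_colombeau f"
    using ex_representative by blast
  obtain b where b: "\<And>g. moderate g \<Longrightarrow>
      (\<lambda>\<epsilon>. norm (g \<epsilon> - f \<epsilon>)) \<in> O[at_right 0](\<lambda>\<epsilon>. \<epsilon> powr b) \<Longrightarrow> abs_colombeau g \<in> S"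
    using openin_sharp_nhd[OF S f(1)] assms(2) f(2) by blast
  define m where "m = nat \<lceil>b\<rceil>"
  have m: "b \<le> real m" unfolding m_def by linarith
  have "\<forall>\<epsilon>. \<exists>w. norm w = 1 \<and> (\<forall>t\<ge>0. norm (f \<epsilon> + t *\<^sub>R w) = norm (f \<epsilon>) + t)"
    using ex_outward_direction[OF assms(1)] by blast
  then obtain w where w: "\<And>\<epsilon>. norm (w \<epsilon>) = 1"
      "\<And>\<epsilon> t. t \<ge> 0 \<Longrightarrow> norm (f \<epsilon> + t *\<^sub>R w \<epsilon>) = norm (f \<epsilon>) + t"
    unfolding choice_iff by blast
  define g where "g = (\<lambda>\<epsilon>. f \<epsilon> + \<epsilon> ^ m *\<^sub>R w \<epsilon>)"
  have "moderate (\<lambda>\<epsilon>. \<epsilon> ^ m *\<^sub>R w \<epsilon>)"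
    by (rule moderate_dominated[OF moderate_power[OF moderate_ident, of m]]) (simp add: w)
  then have modg: "moderate g"
    unfolding g_def using f by (intro moderate_add)
  have "(\<lambda>\<epsilon>. norm (g \<epsilon> - f \<epsilon>)) \<in> O[at_right 0](\<lambda>\<epsilon>. \<epsilon> powr real m)"
  proof (rule bigoI[of _ 1])
    show "\<forall>\<^sub>F \<epsilon> in at_right 0. norm (norm (g \<epsilon> - f \<epsilon>)) \<le> 1 * norm (\<epsilon> powr real m)"
      using eventually_small[OF zero_less_one]
      by eventually_elim (simp add: g_def w powr_realpow)
  qed
  then have "abs_colombeau g \<in> S"
    using bigo_powr_mono m b modg by blast
  from max[OF this] f modg obtain n where n: "negligible_net n"
    and le: "\<forall>\<^sub>F \<epsilon> in at_right 0. norm (g \<epsilon>) \<le> norm (f \<epsilon>) + n \<epsilon>"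
    by (auto simp: gen_norm_abs abs_le_abs_iff moderate_norm)
  from n have "\<forall>\<^sub>F \<epsilon> in at_right 0. norm (n \<epsilon>) \<le> \<epsilon> ^ Suc m"
    unfolding negligible_net_iff_eventually by blast
  with le eventually_small[OF zero_less_one] have "\<forall>\<^sub>F \<epsilon> in at_right (0::real). False"
  proof eventually_elim
    case (elim \<epsilon>)
    then have "\<epsilon> ^ m \<le> n \<epsilon>"
      by (simp add: g_def w)
    moreover have "n \<epsilon> \<le> \<epsilon> * \<epsilon> ^ m"
      using elim by simp
    moreover have "\<epsilon> * \<epsilon> ^ m < 1 * \<epsilon> ^ m"
      using elim by (intro mult_strict_right_mono) auto
    ultimately show False by simp
  qed
  then show False by simp
qed

theorem mainTheorem11:
  shows
    "(\<forall>(A :: 'a::real_normed_vector colombeau set) u.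
        internal A \<and> A \<noteq> {} \<longrightarrow>
        (\<exists>a\<in>A. is_minimum (gen_norm (u - a)) {gen_norm (u - v) | v. v \<in> A}))
     \<and>
     (\<forall>A :: 'a colombeau set.
        internal A \<and> sharply_bounded A \<and> A \<noteq> {} \<longrightarrow>
        (\<exists>m. is_maximum m {gen_norm u | u. u \<in> A}))
     \<and>
     ((\<exists>e::'a. e \<noteq> 0) \<longrightarrow>
       (\<forall>A :: 'a colombeau set.
          internal A \<and> sharply_bounded A \<and> A \<noteq> {} \<longrightarrow>
          \<not> openin sharp_topology A))"
proof (intro conjI allI impI)
  fix A :: "'a colombeau set" and u
  assume "internal A \<and> A \<noteq> {}"
  then obtain a where "a \<in> A" "\<forall>v\<in>A. gen_norm (u - a) \<le>\<^sub>G gen_norm (u - v)"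
    unfolding internal_def using ex_nearest_member by blast
  then show "\<exists>a\<in>A. is_minimum (gen_norm (u - a)) {gen_norm (u - v) | v. v \<in> A}"
    unfolding is_minimum_def by blast
next
  fix A :: "'a colombeau set"
  assume "internal A \<and> sharply_bounded A \<and> A \<noteq> {}"
  then obtain a where "a \<in> A" "\<forall>v\<in>A. gen_norm v \<le>\<^sub>G gen_norm a"
    unfolding internal_def using ex_max_norm_member by blast
  then show "\<exists>m. is_maximum m {gen_norm u | u. u \<in> A}"
    unfolding is_maximum_def by blast
next
  fix A :: "'a colombeau set"
  assume "\<exists>e::'a. e \<noteq> 0"
  then obtain e :: 'a where e: "e \<noteq> 0" by blast
  assume "internal A \<and> sharply_bounded A \<and> A \<noteq> {}"
  then obtain a where "a \<in> A" "\<forall>v\<in>A. gen_norm v \<le>\<^sub>G gen_norm a"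
    unfolding internal_def using ex_max_norm_member by blast
  then show "\<not> openin sharp_topology A"
    using not_open_if_max_norm[OF e] by blast
qed

end
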